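(* Let $d\ge 1$ and let $\Gamma$ be a graph with at least $d+1$ vertices. If $\Gamma$ is $(d+1)$-vertex-connected, then $\Gamma$ is generically neighborhood affinely rigid in $\mathbb{R}^d$; that is, for every generic configuration $p:V(\Gamma)\to\mathbb{R}^d$, the framework $(p,N(\Gamma))$ of the neighborhood hypergraph of $\Gamma$ is affinely rigid in $\mathbb{R}^d$.
   Context: A hypergraph $\Theta$ consists of a finite vertex set $V$ and a set $E$ of hyperedges, each a subset of $V$. A configuration in $\mathbb{R}^d$ is a map $p:V\to\mathbb{R}^d$; a framework is a pair $(p,\Theta)$. Two frameworks $(p,\Theta),(q,\Theta)$ in $\mathbb{R}^d$ are affinely equivalent if for every hyperedge $h$ there is an invertible affine map $g_h$ of $\mathbb{R}^d$ with $g_h(p(u))=q(u)$ for all $u\in h$; they are affinely congruent if a single invertible affine map $g$ of $\mathbb{R}^d$ satisfies $g(p(u))=q(u)$ for all $u\in V$. The framework $(p,\Theta)$ is affinely rigid in $\mathbb{R}^d$ if every framework $(q,\Theta)$ in $\mathbb{R}^d$ affinely equivalent to it is affinely congruent to it. The neighborhood hypergraph $N(\Gamma)$ of a graph $\Gamma$ has the same vertices as $\Gamma$ and, for each vertex $u$, one hyperedge consisting of $u$ together with all its neighbors in $\Gamma$. A configuration is generic if its coordinates satisfy no nonzero polynomial equation with rational coefficients. *)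

theory Defs
  imports "HOL-Analysis.Analysis"
begin

definition simple_graph :: "'a set \<Rightarrow> ('a \<Rightarrow> 'a \<Rightarrow> bool) \<Rightarrow> bool" where
  "simple_graph V E \<longleftrightarrow> finite V \<and> (\<forall>u v. E u v \<longrightarrow> u \<in> V \<and> v \<in> V)
     \<and> (\<forall>u v. E u v \<longrightarrow> E v u) \<and> (\<forall>u. \<not> E u u)"

definition connected_on :: "('a \<Rightarrow> 'a \<Rightarrow> bool) \<Rightarrow> 'a set \<Rightarrow> bool" where
  "connected_on E W \<longleftrightarrow>
     (\<forall>u\<in>W. \<forall>v\<in>W. (\<lambda>x y. x \<in> W \<and> y \<in> W \<and> E x y)\<^sup>*\<^sup>* u v)"

definition vertex_connected :: "'a set \<Rightarrow> ('a \<Rightarrow> 'a \<Rightarrow> bool) \<Rightarrow> nat \<Rightarrow> bool" where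
  "vertex_connected V E k \<longleftrightarrow>
     (\<forall>S. S \<subseteq> V \<and> card S < k \<longrightarrow> connected_on E (V - S))"

definition nbhd_hypergraph :: "'a set \<Rightarrow> ('a \<Rightarrow> 'a \<Rightarrow> bool) \<Rightarrow> 'a set set" where
  "nbhd_hypergraph V E = {insert u {v \<in> V. E u v} | u. u \<in> V}"

definition affinely_equivalent ::
  "'a set set \<Rightarrow> ('a \<Rightarrow> real^'d) \<Rightarrow> ('a \<Rightarrow> real^'d) \<Rightarrow> bool" where
  "affinely_equivalent H p q \<longleftrightarrow>
     (\<forall>h\<in>H. \<exists>(A::real^'d^'d) b. invertible A \<and> (\<forall>u\<in>h. q u = A *v p u + b))"

definition affinely_congruent ::
  "'a set \<Rightarrow> ('a \<Rightarrow> real^'d) \<Rightarrow> ('a \<Rightarrow> real^'d) \<Rightarrow> bool" where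
  "affinely_congruent V p q \<longleftrightarrow>
     (\<exists>(A::real^'d^'d) b. invertible A \<and> (\<forall>u\<in>V. q u = A *v p u + b))"

definition affinely_rigid :: "'a set \<Rightarrow> 'a set set \<Rightarrow> ('a \<Rightarrow> real^'d) \<Rightarrow> bool" where
  "affinely_rigid V H p \<longleftrightarrow>
     (\<forall>q. affinely_equivalent H p q \<longrightarrow> affinely_congruent V p q)"

text \<open>Generic: the coordinates p(v)_i (v in V) satisfy no nonzero polynomial with
  rational coefficients. A polynomial is a finitely supported coefficient map c from
  monomials (exponent functions on V \<times> coordinates) to rationals.\<close>
definition generic :: "'a set \<Rightarrow> ('a \<Rightarrow> real^'d) \<Rightarrow> bool" where
  "generic V p \<longleftrightarrow>
     (\<forall>c :: (('a \<times> 'd) \<Rightarrow> nat) \<Rightarrow> rat.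
        finite {m. c m \<noteq> 0}
        \<and> (\<forall>m. c m \<noteq> 0 \<longrightarrow> (\<forall>k. k \<notin> V \<times> UNIV \<longrightarrow> m k = 0))
        \<and> (\<Sum>m\<in>{m. c m \<noteq> 0}. of_rat (c m) * (\<Prod>k\<in>V \<times> UNIV. (p (fst k) $ snd k) ^ m k)) = 0
        \<longrightarrow> (\<forall>m. c m = 0))"

end

theory Submission
  imports Defs
begin

text \<open>Let \<open>k = d + 1\<close> and fix a set \<open>X\<close> of \<open>k\<close> vertices. Every vertex outside \<open>X\<close> gets generic weights on
  its closed neighborhood; solving the resulting equilibrium equations with the vertices of \<open>X\<close>
  pinned to a basis gives a "rubber band" placement in homogeneous coordinates. Any \<open>k\<close> vertices
  \<open>U\<close> are independent in it as soon as the weight matrix with columns outside \<open>U\<close> is nonsingular for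
  one choice of the weights, and connectivity provides one, supported on a matching, by Hall's
  theorem. Hence in this placement the only scalar function that vanishes on \<open>X\<close> and is affine on
  every closed neighborhood outside \<open>X\<close> is zero. This is the injectivity of a linear system whose
  entries are rational polynomials in the coordinates, so it passes to every generic placement.
  Applied to \<open>q\<close> minus the affine map interpolating it on \<open>X\<close>, it yields rigidity.\<close>

section \<open>Rational polynomial functions\<close>

text \<open>Polynomials are handled as functions with closure rules, so that elimination on matrices
  with polynomial entries needs no bookkeeping of coefficients. Explicit coefficients appear only
  when genericity is invoked.\<close>

inductive rat_polyfun :: "'k set \<Rightarrow> (('k \<Rightarrow> real) \<Rightarrow> real) \<Rightarrow> bool" for K where
  const: "rat_polyfun K (\<lambda>x. of_rat c)"
| var: "k \<in> K \<Longrightarrow> rat_polyfun K (\<lambda>x. x k)"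
| add: "rat_polyfun K f \<Longrightarrow> rat_polyfun K g \<Longrightarrow> rat_polyfun K (\<lambda>x. f x + g x)"
| mult: "rat_polyfun K f \<Longrightarrow> rat_polyfun K g \<Longrightarrow> rat_polyfun K (\<lambda>x. f x * g x)"

lemma rat_polyfun_0: "rat_polyfun K (\<lambda>x. 0)"
  using rat_polyfun.const[of K 0] by simp

lemma rat_polyfun_1: "rat_polyfun K (\<lambda>x. 1)"
  using rat_polyfun.const[of K 1] by simp

lemma rat_polyfun_minus:
  assumes "rat_polyfun K f"
  shows "rat_polyfun K (\<lambda>x. - f x)"
  using rat_polyfun.mult[OF rat_polyfun.const[of K "-1"] assms] by (simp add: of_rat_minus)

lemma rat_polyfun_diff:
  assumes "rat_polyfun K f" "rat_polyfun K g"
  shows "rat_polyfun K (\<lambda>x. f x - g x)"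
  using rat_polyfun.add[OF assms(1) rat_polyfun_minus[OF assms(2)]] by simp

lemma rat_polyfun_prod:
  "(\<And>j. j \<in> J \<Longrightarrow> rat_polyfun K (f j)) \<Longrightarrow> rat_polyfun K (\<lambda>x. \<Prod>j\<in>J. f j x)"
proof (induction J rule: infinite_finite_induct)
  case (insert j J)
  then show ?case by (simp add: rat_polyfun.mult)
qed (simp_all add: rat_polyfun_1)

section \<open>From polynomial functions to explicit coefficients\<close>

definition poly_sum_form :: "'k set \<Rightarrow> (('k \<Rightarrow> real) \<Rightarrow> real) \<Rightarrow> bool" where
  "poly_sum_form K f \<longleftrightarrow> (\<exists>(c :: ('k \<Rightarrow> nat) \<Rightarrow> rat) M. finite M \<and> (\<forall>m. m \<notin> M \<longrightarrow> c m = 0)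
     \<and> (\<forall>m\<in>M. \<forall>k. k \<notin> K \<longrightarrow> m k = 0)
     \<and> (\<forall>x. f x = (\<Sum>m\<in>M. of_rat (c m) * (\<Prod>k\<in>K. x k ^ m k))))"

lemma poly_sum_form_1: "poly_sum_form K (\<lambda>x. 1)"
  unfolding poly_sum_form_def
  by (rule exI[of _ "\<lambda>m. if m = (\<lambda>_. 0) then 1 else 0"], rule exI[of _ "{\<lambda>_. 0}"]) auto

lemma poly_sum_form_add:
  assumes "poly_sum_form K f" "poly_sum_form K g"
  shows "poly_sum_form K (\<lambda>x. f x + g x)"
proof -
  obtain c M where f: "finite M" "\<forall>m. m \<notin> M \<longrightarrow> c m = 0" "\<forall>m\<in>M. \<forall>k. k \<notin> K \<longrightarrow> m k = 0"
    "\<forall>x. f x = (\<Sum>m\<in>M. of_rat (c m) * (\<Prod>k\<in>K. x k ^ m k))"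
    using assms(1) unfolding poly_sum_form_def by blast
  obtain c' M' where g: "finite M'" "\<forall>m. m \<notin> M' \<longrightarrow> c' m = 0" "\<forall>m\<in>M'. \<forall>k. k \<notin> K \<longrightarrow> m k = 0"
    "\<forall>x. g x = (\<Sum>m\<in>M'. of_rat (c' m) * (\<Prod>k\<in>K. x k ^ m k))"
    using assms(2) unfolding poly_sum_form_def by blast
  have "f x = (\<Sum>m\<in>M \<union> M'. of_rat (c m) * (\<Prod>k\<in>K. x k ^ m k))" for x
    unfolding f(4)[rule_format] using f g by (intro sum.mono_neutral_left) auto
  moreover have "g x = (\<Sum>m\<in>M \<union> M'. of_rat (c' m) * (\<Prod>k\<in>K. x k ^ m k))" for x
    unfolding g(4)[rule_format] using f g by (intro sum.mono_neutral_left) auto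
  ultimately show ?thesis
    unfolding poly_sum_form_def using f(1-3) g(1-3)
    by (intro exI[of _ "\<lambda>m. c m + c' m"] exI[of _ "M \<union> M'"])
      (auto simp: of_rat_add distrib_right sum.distrib)
qed

lemma poly_sum_form_const_mult:
  assumes "poly_sum_form K f"
  shows "poly_sum_form K (\<lambda>x. of_rat a * f x)"
proof -
  obtain c M where f: "finite M" "\<forall>m. m \<notin> M \<longrightarrow> c m = 0" "\<forall>m\<in>M. \<forall>k. k \<notin> K \<longrightarrow> m k = 0"
    "\<forall>x. f x = (\<Sum>m\<in>M. of_rat (c m) * (\<Prod>k\<in>K. x k ^ m k))"
    using assms unfolding poly_sum_form_def by blast
  then show ?thesis
    unfolding poly_sum_form_def
    by (intro exI[of _ "\<lambda>m. a * c m"] exI[of _ M])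
      (auto simp: of_rat_mult sum_distrib_left mult.assoc)
qed

text \<open>Multiplication by a variable shifts exponents by the injective map \<open>s\<close>, so
  no two monomials merge and the coefficients are carried along \<open>s\<close>.\<close>

lemma poly_sum_form_var_mult:
  assumes "poly_sum_form K f" "k \<in> K" "finite K"
  shows "poly_sum_form K (\<lambda>x. x k * f x)"
proof -
  obtain c M where f: "finite M" "\<forall>m. m \<notin> M \<longrightarrow> c m = 0" "\<forall>m\<in>M. \<forall>k. k \<notin> K \<longrightarrow> m k = 0"
    "\<forall>x. f x = (\<Sum>m\<in>M. of_rat (c m) * (\<Prod>k\<in>K. x k ^ m k))"
    using assms(1) unfolding poly_sum_form_def by blast
  define s where "s m = m(k := Suc (m k))" for m :: "'a \<Rightarrow> nat"
  have inj: "inj s"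
  proof (rule injI)
    fix m m' assume eq: "s m = s m'"
    show "m = m'"
    proof
      fix j show "m j = m' j"
        using fun_cong[OF eq, of j] by (cases "j = k") (auto simp: s_def)
    qed
  qed
  define c' where "c' m = (if m \<in> range s then c (inv s m) else 0)" for m
  have c's: "c' (s m) = c m" for m
    by (simp add: c'_def inv_f_f[OF inj])
  have mono: "x k * (\<Prod>j\<in>K. x j ^ m j) = (\<Prod>j\<in>K. x j ^ s m j)" for x :: "'a \<Rightarrow> real" and m
  proof -
    have "(\<Prod>j\<in>K. x j ^ s m j) = x k ^ s m k * (\<Prod>j\<in>K - {k}. x j ^ s m j)"
      using assms by (simp add: prod.remove)
    also have "(\<Prod>j\<in>K - {k}. x j ^ s m j) = (\<Prod>j\<in>K - {k}. x j ^ m j)"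
      by (rule prod.cong) (auto simp: s_def)
    finally show ?thesis
      using assms by (simp add: prod.remove[of K k "\<lambda>j. x j ^ m j"] s_def)
  qed
  have "x k * f x = (\<Sum>m\<in>s ` M. of_rat (c' m) * (\<Prod>j\<in>K. x j ^ m j))" for x
    unfolding f(4)[rule_format] sum.reindex[OF inj_on_subset[OF inj subset_UNIV]]
    by (simp add: c's mono[symmetric] sum_distrib_left algebra_simps)
  moreover have "c' m = 0" if "m \<notin> s ` M" for m
    using that f(2) by (auto simp: c'_def inv_f_f[OF inj])
  moreover have "\<forall>m\<in>s ` M. \<forall>j. j \<notin> K \<longrightarrow> m j = 0"
    using f(3) assms(2) by (auto simp: s_def)
  ultimately show ?thesis
    unfolding poly_sum_form_def using f(1)
    by (intro exI[of _ c'] exI[of _ "s ` M"]) auto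
qed

lemma rat_polyfun_sum_form:
  assumes "rat_polyfun K f" "finite K"
  shows "poly_sum_form K f"
proof -
  \<comment> \<open>The induction shows that multiplication by \<open>f\<close> preserves sum form,
    rather than that \<open>f\<close> has one. The product case is then a composition of two such
    multiplications, and two sums never have to be multiplied out. Taking \<open>g\<close> to be 1
    gives the claim.\<close>
  have "poly_sum_form K (\<lambda>x. f x * g x)" if "poly_sum_form K g" for g
    using assms(1) that
  proof (induction arbitrary: g)
    case (const c)
    then show ?case by (rule poly_sum_form_const_mult)
  next
    case (var k)
    from poly_sum_form_var_mult[OF var.prems var.hyps assms(2)] show ?case .
  next
    case (add f1 f2)
    from poly_sum_form_add[OF add.IH[OF add.prems]] show ?case by (simp add: distrib_right)
  next
    case (mult f1 f2)
    from mult.IH(1)[OF mult.IH(2)[OF mult.prems]] show ?case by (simp add: mult.assoc)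
  qed
  from this[OF poly_sum_form_1] show ?thesis by simp
qed

text \<open>The one gateway through which genericity is used: to prove an open algebraic condition
  at \<open>p\<close>, it suffices to express it by a rational polynomial and exhibit a single point
  where that polynomial is nonzero.\<close>

lemma generic_rat_polyfun_nonzero:
  fixes p :: "'a \<Rightarrow> real^'d"
  assumes "generic V p" "finite V" "rat_polyfun (V \<times> UNIV) F" "F x \<noteq> 0"
  shows "F (\<lambda>(v, i). p v $ i) \<noteq> 0"
proof
  assume zero: "F (\<lambda>(v, i). p v $ i) = 0"
  obtain c M where f: "finite M" "\<forall>m. m \<notin> M \<longrightarrow> c m = 0"
    "\<forall>m\<in>M. \<forall>k. k \<notin> V \<times> UNIV \<longrightarrow> m k = 0"
    "\<forall>x. F x = (\<Sum>m\<in>M. of_rat (c m) * (\<Prod>k\<in>V \<times> UNIV. x k ^ m k))"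
    using rat_polyfun_sum_form[OF assms(3)] assms(2) unfolding poly_sum_form_def by auto
  have sub: "{m. c m \<noteq> 0} \<subseteq> M" using f(2) by auto
  have "(\<Sum>m\<in>{m. c m \<noteq> 0}. of_rat (c m) * (\<Prod>k\<in>V \<times> UNIV. (p (fst k) $ snd k) ^ m k))
      = F (\<lambda>(v, i). p v $ i)"
    unfolding f(4)[rule_format] case_prod_beta
    by (rule sum.mono_neutral_left) (use f(1) sub in auto)
  moreover have "\<forall>m. c m \<noteq> 0 \<longrightarrow> (\<forall>k. k \<notin> V \<times> UNIV \<longrightarrow> m k = 0)"
    using f(3) sub by blast
  moreover have "finite {m. c m \<noteq> 0}"
    using sub f(1) by (rule finite_subset)
  ultimately have "\<forall>m. c m = 0"
    using assms(1)[unfolded generic_def, THEN spec[of _ c]] zero by argo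
  then have "F x = 0" using f(4) by simp
  with assms(4) show False by simp
qed

section \<open>Common nonzeros of finitely many polynomials\<close>

lemma rat_polyfun_on_line:
  assumes "rat_polyfun K f"
  shows "\<exists>q. \<forall>t. f (\<lambda>k. a k + t * b k) = poly q t"
  using assms
proof induction
  case (const c)
  show ?case by (rule exI[of _ "[:of_rat c:]"]) simp
next
  case (var k)
  show ?case by (rule exI[of _ "[:a k, b k:]"]) simp
next
  case (add f g)
  then show ?case by (metis poly_add)
next
  case (mult f g)
  then show ?case by (metis poly_mult)
qed

text \<open>On the line through \<open>a\<close> and \<open>b\<close> both functions become nonzero
  univariate polynomials, whose product has finitely many roots.\<close>

lemma rat_polyfun_common_nonzero2:
  assumes "rat_polyfun K f" "rat_polyfun K g" "f a \<noteq> 0" "g b \<noteq> 0"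
  shows "\<exists>x. f x \<noteq> 0 \<and> g x \<noteq> 0"
proof -
  define l where "l t = (\<lambda>k. a k + t * (b k - a k))" for t :: real
  obtain q r where qr: "\<And>t. f (l t) = poly q t" "\<And>t. g (l t) = poly r t"
    using rat_polyfun_on_line[OF assms(1), of a "\<lambda>k. b k - a k"]
      rat_polyfun_on_line[OF assms(2), of a "\<lambda>k. b k - a k"] unfolding l_def by auto
  have "l 0 = a" "l 1 = b" by (auto simp: l_def)
  then have "poly q 0 \<noteq> 0" "poly r 1 \<noteq> 0" using qr assms(3,4) by metis+
  then have "q * r \<noteq> 0" by auto
  then have "{t. poly (q * r) t = 0} \<noteq> UNIV"
    using poly_roots_finite[of "q * r"] infinite_UNIV_char_0[where 'a = real] by metis
  then obtain t where "poly (q * r) t \<noteq> 0" by auto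
  then show ?thesis using qr by (intro exI[of _ "l t"]) auto
qed

lemma rat_polyfun_common_nonzero:
  assumes "finite J" "\<And>j. j \<in> J \<Longrightarrow> rat_polyfun K (F j)" "\<And>j. j \<in> J \<Longrightarrow> \<exists>x. F j x \<noteq> 0"
  shows "\<exists>x. \<forall>j\<in>J. F j x \<noteq> 0"
  using assms
proof (induction J)
  case (insert j J)
  then obtain a b where "F j b \<noteq> 0" "\<forall>i\<in>J. F i a \<noteq> 0" by blast
  moreover have "rat_polyfun K (\<lambda>x. \<Prod>i\<in>J. F i x)"
    using insert.prems by (intro rat_polyfun_prod) auto
  ultimately show ?case
    using rat_polyfun_common_nonzero2[of K "F j" "\<lambda>x. \<Prod>i\<in>J. F i x" b a] insert.prems insert.hyps
    by auto
qed simp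

section \<open>Linear systems with polynomial entries\<close>

text \<open>Rows and columns are arbitrary sets rather than types, because elimination removes
  columns one at a time and the column set \<open>V - U\<close> varies with
  \<open>U\<close>.\<close>

definition trivial_kernel :: "'i set \<Rightarrow> 'j set \<Rightarrow> ('i \<Rightarrow> 'j \<Rightarrow> real) \<Rightarrow> bool" where
  "trivial_kernel I J M \<longleftrightarrow>
     (\<forall>z. (\<forall>i\<in>I. (\<Sum>j\<in>J. M i j * z j) = 0) \<longrightarrow> (\<forall>j\<in>J. z j = 0))"

lemma trivial_kernelD:
  "trivial_kernel I J M \<Longrightarrow> (\<And>i. i \<in> I \<Longrightarrow> (\<Sum>j\<in>J. M i j * z j) = 0) \<Longrightarrow> j \<in> J \<Longrightarrow> z j = 0"
  unfolding trivial_kernel_def by blast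

text \<open>One step of Gaussian elimination, without division so that polynomial entries stay
  polynomial. Row \<open>i\<close> becomes zero in the reduced system, so it can stay in the row
  set.\<close>

lemma trivial_kernel_pivot:
  assumes "finite J" "j \<notin> J" "i \<in> I" "M i j \<noteq> 0"
  shows "trivial_kernel I (insert j J) M
    \<longleftrightarrow> trivial_kernel I J (\<lambda>i' j'. M i j * M i' j' - M i' j * M i j')"
proof
  assume L: "trivial_kernel I (insert j J) M"
  show "trivial_kernel I J (\<lambda>i' j'. M i j * M i' j' - M i' j * M i j')"
    unfolding trivial_kernel_def
  proof (intro allI impI)
    fix z assume z: "\<forall>i'\<in>I. (\<Sum>j'\<in>J. (M i j * M i' j' - M i' j * M i j') * z j') = 0"
    define y where "y = z(j := - (\<Sum>j'\<in>J. M i j' * z j') / M i j)"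
    have yJ: "(\<Sum>j'\<in>J. M i' j' * y j') = (\<Sum>j'\<in>J. M i' j' * z j')" for i'
      by (rule sum.cong) (use assms in \<open>auto simp: y_def\<close>)
    have "(\<Sum>j'\<in>insert j J. M i' j' * y j') = 0" if "i' \<in> I" for i'
    proof -
      have "M i j * (\<Sum>j'\<in>J. M i' j' * z j') - M i' j * (\<Sum>j'\<in>J. M i j' * z j') = 0"
        using z[rule_format, OF that]
        by (simp add: sum_distrib_left left_diff_distrib sum_subtractf mult.assoc)
      then show ?thesis
        using assms yJ by (simp add: y_def field_simps)
    qed
    then have "\<forall>j'\<in>insert j J. y j' = 0"
      using L unfolding trivial_kernel_def by blast
    then show "\<forall>j'\<in>J. z j' = 0" using assms(2) by (auto simp: y_def split: if_splits)
  qed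
next
  assume R: "trivial_kernel I J (\<lambda>i' j'. M i j * M i' j' - M i' j * M i j')"
  show "trivial_kernel I (insert j J) M"
    unfolding trivial_kernel_def
  proof (intro allI impI)
    fix z assume z: "\<forall>i'\<in>I. (\<Sum>j'\<in>insert j J. M i' j' * z j') = 0"
    then have z': "(\<Sum>j'\<in>J. M i' j' * z j') = - (M i' j * z j)" if "i' \<in> I" for i'
      using that assms by (simp add: eq_neg_iff_add_eq_0 add.commute)
    have "(\<Sum>j'\<in>J. (M i j * M i' j' - M i' j * M i j') * z j') = 0" if "i' \<in> I" for i'
    proof -
      have "(\<Sum>j'\<in>J. (M i j * M i' j' - M i' j * M i j') * z j')
          = M i j * (\<Sum>j'\<in>J. M i' j' * z j') - M i' j * (\<Sum>j'\<in>J. M i j' * z j')"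
        by (simp add: sum_distrib_left algebra_simps sum_subtractf)
      then show ?thesis using z'[OF that] z'[OF assms(3)] by simp
    qed
    then have 0: "\<forall>j'\<in>J. z j' = 0" using R unfolding trivial_kernel_def by blast
    then show "\<forall>j'\<in>insert j J. z j' = 0" using z' [OF assms(3)] assms(4) by auto
  qed
qed

text \<open>Elimination is run with pivots that are nonzero at \<open>x0\<close>, and
  \<open>F\<close> is the product of the pivots. Wherever \<open>F\<close> is nonzero the same
  elimination succeeds. This plays the part of a nonvanishing maximal minor.\<close>

lemma rat_polyfun_trivial_kernel:
  assumes "finite J" "\<And>i j. i \<in> I \<Longrightarrow> j \<in> J \<Longrightarrow> rat_polyfun K (A i j)"
    and "trivial_kernel I J (\<lambda>i j. A i j x0)"
  shows "\<exists>F. rat_polyfun K F \<and> F x0 \<noteq> 0 \<and> (\<forall>x. F x \<noteq> 0 \<longrightarrow> trivial_kernel I J (\<lambda>i j. A i j x))"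
  using assms
proof (induction J arbitrary: A)
  case empty
  show ?case using rat_polyfun_1[of K] by (auto simp: trivial_kernel_def)
next
  case (insert j J)
  \<comment> \<open>If column \<open>j\<close> vanished at \<open>x0\<close>, the unit vector at
    \<open>j\<close> would lie in the kernel.\<close>
  have "\<exists>i\<in>I. A i j x0 \<noteq> 0"
  proof (rule ccontr)
    assume "\<not> ?thesis"
    then have "(\<Sum>j'\<in>insert j J. A i j' x0 * (if j' = j then 1 else 0)) = 0" if "i \<in> I" for i
      using that by (intro sum.neutral) auto
    from trivial_kernelD[OF insert.prems(2) this, of j] show False by simp
  qed
  then obtain i where i: "i \<in> I" "A i j x0 \<noteq> 0" by blast
  let ?B = "\<lambda>i' j' x. A i j x * A i' j' x - A i' j x * A i j' x"
  have "trivial_kernel I J (\<lambda>i' j'. ?B i' j' x0)"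
    using insert.prems(2) trivial_kernel_pivot[OF insert.hyps i(1), of "\<lambda>i j. A i j x0"] i(2) by simp
  then obtain F where F: "rat_polyfun K F" "F x0 \<noteq> 0"
    "\<And>x. F x \<noteq> 0 \<Longrightarrow> trivial_kernel I J (\<lambda>i' j'. ?B i' j' x)"
    using insert.IH[of ?B] insert.prems(1) i(1)
    by (force intro: rat_polyfun_diff rat_polyfun.mult)
  show ?case
    using rat_polyfun.mult[OF insert.prems(1)[OF i(1), of j] F(1)] F(2,3) i
      trivial_kernel_pivot[OF insert.hyps i(1)]
    by (intro exI[of _ "\<lambda>x. A i j x * F x"]) auto
qed

section \<open>Counting rows and columns\<close>

lemma underdetermined_not_trivial_kernel:
  assumes "finite I" "finite J" "card I < card J"
  shows "\<not> trivial_kernel I J M"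
  using assms
proof (induction I arbitrary: J M)
  case empty
  then obtain j where "j \<in> J" by fastforce
  then show ?case by (auto simp: trivial_kernel_def intro!: exI[of _ "\<lambda>_. 1"])
next
  case (insert i I)
  show ?case
  proof (cases "\<exists>j\<in>J. M i j \<noteq> 0")
    case False
    have "\<not> trivial_kernel I J M" using insert by simp
    moreover have "(\<Sum>j\<in>J. M i j * z j) = 0" for z using False by (intro sum.neutral) auto
    ultimately show ?thesis unfolding trivial_kernel_def by auto
  next
    case True
    then obtain j where j: "j \<in> J" "M i j \<noteq> 0" by blast
    let ?B = "\<lambda>i' j'. M i j * M i' j' - M i' j * M i j'"
    have "card I < card (J - {j})" using insert j by simp
    then have "\<not> trivial_kernel I (J - {j}) ?B" using insert by simp
    \<comment> \<open>The pivot row of \<open>?B\<close> is identically zero, so restoring it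
      imposes no condition.\<close>
    then have "\<not> trivial_kernel (insert i I) (J - {j}) ?B"
      unfolding trivial_kernel_def by (auto simp: mult.commute)
    then show ?thesis
      using trivial_kernel_pivot[of "J - {j}" j i "insert i I" M] insert.prems j
      by (simp add: insert_absorb)
  qed
qed

text \<open>The right-hand side is adjoined as an extra column indexed by \<open>None\<close>. The
  enlarged system has more columns than rows, hence a nonzero kernel vector; its entry at
  \<open>None\<close> is nonzero because the original kernel is trivial, and normalizing that entry
  to -1 gives a solution.\<close>

lemma square_trivial_kernel_solvable:
  assumes "finite I" "finite J" "card I = card J" "trivial_kernel I J M"
  shows "\<exists>z. \<forall>i\<in>I. (\<Sum>j\<in>J. M i j * z j) = b i"
proof -
  let ?J = "insert None (Some ` J)"
  let ?M = "\<lambda>i j. case j of None \<Rightarrow> b i | Some j \<Rightarrow> M i j"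
  have sum: "(\<Sum>j\<in>?J. ?M i j * y j) = b i * y None + (\<Sum>j\<in>J. M i j * y (Some j))" for y i
    using assms(2) by (simp add: sum.reindex)
  have "card ?J = Suc (card J)" using assms(2) by (simp add: card_image)
  then have "\<not> trivial_kernel I ?J ?M"
    using assms by (intro underdetermined_not_trivial_kernel) auto
  then obtain y where y: "\<And>i. i \<in> I \<Longrightarrow> b i * y None + (\<Sum>j\<in>J. M i j * y (Some j)) = 0"
    and nz: "\<exists>j\<in>?J. y j \<noteq> 0"
    unfolding trivial_kernel_def sum by blast
  have "y None \<noteq> 0"
  proof
    assume 0: "y None = 0"
    then have "\<And>j. j \<in> J \<Longrightarrow> y (Some j) = 0"
      using trivial_kernelD[OF assms(4), of "\<lambda>j. y (Some j)"] y by simp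
    with 0 nz show False by auto
  qed
  have "(\<Sum>j\<in>J. M i j * (- y (Some j) / y None)) = b i" if "i \<in> I" for i
  proof -
    have "(\<Sum>j\<in>J. M i j * (- y (Some j) / y None)) = - (\<Sum>j\<in>J. M i j * y (Some j)) / y None"
      by (simp add: sum_divide_distrib flip: sum_negf)
    also have "\<dots> = b i"
      using y[OF that] \<open>y None \<noteq> 0\<close> by (simp add: field_simps)
    finally show ?thesis .
  qed
  then show ?thesis by (intro exI ballI)
qed

section \<open>Connectivity and matchings\<close>

lemma hall_marriage:
  assumes "finite I" "\<And>i. i \<in> I \<Longrightarrow> finite (A i)"
    and "\<And>J. J \<subseteq> I \<Longrightarrow> card J \<le> card (\<Union>i\<in>J. A i)"
  shows "\<exists>f. inj_on f I \<and> (\<forall>i\<in>I. f i \<in> A i)"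
  using assms
proof (induction I arbitrary: A rule: finite_psubset_induct)
  case (psubset I)
  have finU: "finite (\<Union>i\<in>J. A i)" if "J \<subseteq> I" for J
    using that psubset.prems(1) finite_subset[OF that psubset.hyps] by blast
  show ?case
  proof (cases "\<exists>J. J \<subset> I \<and> J \<noteq> {} \<and> card (\<Union>i\<in>J. A i) = card J")
    case True
    then obtain J where J: "J \<subset> I" "J \<noteq> {}" "card (\<Union>i\<in>J. A i) = card J" by blast
    obtain f where f: "inj_on f J" "\<forall>i\<in>J. f i \<in> A i"
      using psubset.IH[OF J(1), of A] psubset.prems J(1) by (metis psubsetE subset_iff)
    \<comment> \<open>The tight set \<open>J\<close> uses up all of its candidates, so these are
      reserved for it. Hall's condition for \<open>L\<close> after the removal follows from the one
      for \<open>L \<union> J\<close>, since \<open>J\<close> accounts for exactly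
      \<open>card J\<close> elements.\<close>
    define B where "B i = A i - (\<Union>j\<in>J. A j)" for i
    have "\<exists>g. inj_on g (I - J) \<and> (\<forall>i\<in>I - J. g i \<in> B i)"
    proof (rule psubset.IH)
      show "I - J \<subset> I" using J by blast
      show "\<And>i. i \<in> I - J \<Longrightarrow> finite (B i)" using psubset.prems(1) by (auto simp: B_def)
      fix L assume L: "L \<subseteq> I - J"
      have fin: "finite L" "finite J"
        using L J(1) psubset.hyps by (auto intro: finite_subset)
      have "card L + card J = card (L \<union> J)"
        using L fin by (subst card_Un_disjoint) auto
      also have "\<dots> \<le> card (\<Union>i\<in>L \<union> J. A i)"
        using L J(1) by (intro psubset.prems(2)) auto
      also have "\<dots> = card ((\<Union>i\<in>L. B i) \<union> (\<Union>i\<in>J. A i))"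
        by (rule arg_cong[of _ _ card]) (auto simp: B_def)
      also have "\<dots> \<le> card (\<Union>i\<in>L. B i) + card J"
        using card_Un_le[of "\<Union>i\<in>L. B i" "\<Union>i\<in>J. A i"] J(3) by simp
      finally show "card L \<le> card (\<Union>i\<in>L. B i)" by simp
    qed
    then obtain g where g: "inj_on g (I - J)" "\<forall>i\<in>I - J. g i \<in> B i" by blast
    show ?thesis
    proof (intro exI conjI)
      have "f ` J \<inter> g ` (I - J) = {}" using f g by (force simp: B_def)
      then show "inj_on (\<lambda>i. if i \<in> J then f i else g i) I"
        using inj_on_disjoint_Un[OF f(1) g(1)] J(1) by (simp add: Un_absorb1 psubset_imp_subset)
      show "\<forall>i\<in>I. (if i \<in> J then f i else g i) \<in> A i"
        using f g by (auto simp: B_def)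
    qed
  next
    case False
    show ?thesis
    proof (cases "I = {}")
      case False
      then obtain i0 where i0: "i0 \<in> I" by blast
      have "A i0 \<noteq> {}" using psubset.prems(2)[of "{i0}"] i0 by auto
      then obtain a where a: "a \<in> A i0" by blast
      \<comment> \<open>With no tight nonempty proper subset, every such subset has a surplus of at
        least one, which pays for removing \<open>a\<close>. Hence \<open>i0\<close> may be matched
        to any of its candidates.\<close>
      define B where "B i = A i - {a}" for i
      have "\<exists>g. inj_on g (I - {i0}) \<and> (\<forall>i\<in>I - {i0}. g i \<in> B i)"
      proof (rule psubset.IH)
        show "I - {i0} \<subset> I" using i0 by blast
        show "\<And>i. i \<in> I - {i0} \<Longrightarrow> finite (B i)" using psubset.prems(1) by (auto simp: B_def)
        fix L assume L: "L \<subseteq> I - {i0}"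
        show "card L \<le> card (\<Union>i\<in>L. B i)"
        proof (cases "L = {}")
          case False
          have "L \<subset> I" using L i0 by blast
          then have "card L < card (\<Union>i\<in>L. A i)"
            using False \<open>\<not> (\<exists>J. _ J)\<close> psubset.prems(2)[of L] by (metis le_neq_implies_less psubset_imp_subset)
          moreover have "(\<Union>i\<in>L. B i) = (\<Union>i\<in>L. A i) - {a}" by (auto simp: B_def)
          ultimately show ?thesis using diff_card_le_card_Diff[of "{a}" "\<Union>i\<in>L. A i"] by simp
        qed simp
      qed
      then obtain g where g: "inj_on g (I - {i0})" "\<forall>i\<in>I - {i0}. g i \<in> B i" by blast
      show ?thesis
      proof (intro exI conjI)
        have "(\<lambda>_. a) ` {i0} \<inter> g ` (I - {i0}) = {}" using g by (force simp: B_def)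
        then show "inj_on (\<lambda>i. if i = i0 then a else g i) I"
          using inj_on_disjoint_Un[OF _ g(1), of "\<lambda>_. a" "{i0}"] i0 by (simp add: insert_absorb)
        show "\<forall>i\<in>I. (if i = i0 then a else g i) \<in> A i"
          using g a by (auto simp: B_def)
      qed
    qed simp
  qed
qed

section \<open>Closed neighborhoods and vertex separators\<close>

definition closed_nbhd :: "'a set \<Rightarrow> ('a \<Rightarrow> 'a \<Rightarrow> bool) \<Rightarrow> 'a \<Rightarrow> 'a set" where
  "closed_nbhd V E u = insert u {v \<in> V. E u v}"

lemma closed_nbhd_subset: "u \<in> V \<Longrightarrow> closed_nbhd V E u \<subseteq> V"
  by (auto simp: closed_nbhd_def)

lemma self_in_closed_nbhd: "u \<in> closed_nbhd V E u"
  by (simp add: closed_nbhd_def)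

text \<open>The outer boundary of \<open>W\<close> separates \<open>W\<close> from the vertices that
  its closed neighborhoods miss. Were it smaller than \<open>k\<close>, its deletion would leave a
  connected graph.\<close>

lemma separator_card:
  assumes "vertex_connected V E k" "finite V" "W \<subseteq> V" "W \<noteq> {}"
    and "(\<Union>w\<in>W. closed_nbhd V E w) \<noteq> V"
  shows "k \<le> card ((\<Union>w\<in>W. closed_nbhd V E w) - W)"
proof (rule ccontr)
  let ?N = "\<Union>w\<in>W. closed_nbhd V E w"
  let ?S = "?N - W"
  assume "\<not> ?thesis"
  have N: "?N \<subseteq> V" "W \<subseteq> ?N"
    using assms(3) self_in_closed_nbhd by (auto simp: closed_nbhd_def)
  with \<open>\<not> ?thesis\<close> assms(1) have con: "connected_on E (V - ?S)"
    unfolding vertex_connected_def by (metis Diff_subset not_le subset_trans)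
  obtain w r where w: "w \<in> W" and r: "r \<in> V" "r \<notin> ?N" using assms(4,5) N by blast
  let ?R = "\<lambda>x y. x \<in> V - ?S \<and> y \<in> V - ?S \<and> E x y"
  have "?R\<^sup>*\<^sup>* w r"
    using con w r assms(3) N unfolding connected_on_def by blast
  \<comment> \<open>An edge leaving \<open>W\<close> ends in \<open>?S\<close>, which has been
    deleted, so a walk starting in \<open>W\<close> stays there.\<close>
  then have "r \<in> W"
  proof induction
    case (step y z)
    then show ?case by (auto simp: closed_nbhd_def)
  qed (rule w)
  with r N show False by blast
qed

text \<open>Used to find, inside a single closed neighborhood, enough vertices to determine an
  affine map.\<close>

lemma closed_nbhd_card:
  assumes "vertex_connected V E k" "finite V" "k \<le> card V" "u \<in> V"
  shows "k \<le> card (closed_nbhd V E u)"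
proof (cases "closed_nbhd V E u = V")
  case False
  then have "k \<le> card (closed_nbhd V E u - {u})"
    using separator_card[of V E k "{u}"] assms by simp
  also have "\<dots> \<le> card (closed_nbhd V E u)"
    using assms(2,4) by (intro card_mono) (auto intro: finite_subset[OF closed_nbhd_subset])
  finally show ?thesis .
qed (use assms in simp)

text \<open>Such a bijection encodes a family of disjoint paths joining \<open>U\<close> to \<open>X\<close>, together with
  fixed points; obtaining it from Hall's theorem replaces an appeal to Menger's theorem.\<close>
lemma vertex_connected_matching:
  assumes "vertex_connected V E k" "finite V" "X \<subseteq> V" "card X = k" "U \<subseteq> V" "card U = k"
  obtains f where "bij_betw f (V - X) (V - U)" "\<And>v. v \<in> V - X \<Longrightarrow> f v \<in> closed_nbhd V E v"
proof -
  have fin: "finite X" "finite U"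
    using assms finite_subset by blast+
  have "\<exists>f. inj_on f (V - X) \<and> (\<forall>v\<in>V - X. f v \<in> closed_nbhd V E v - U)"
  proof (rule hall_marriage)
    show "finite (V - X)" using assms(2) by simp
    show "finite (closed_nbhd V E v - U)" if "v \<in> V - X" for v
      using that assms(2) closed_nbhd_subset[of v V E] by (auto intro: finite_subset)
    fix W assume W: "W \<subseteq> V - X"
    let ?N = "\<Union>w\<in>W. closed_nbhd V E w"
    have N: "?N \<subseteq> V" "W \<subseteq> ?N"
      using W self_in_closed_nbhd by (auto simp: closed_nbhd_def)
    have finN: "finite ?N" using finite_subset[OF N(1) assms(2)] .
    have finW: "finite W" using finite_subset[OF N(2) finN] .
    show "card W \<le> card (\<Union>w\<in>W. closed_nbhd V E w - U)"
    proof (cases "W = {}")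
      case False
      \<comment> \<open>Hall's condition after deleting \<open>U\<close> needs a surplus of
        \<open>k\<close>. The surplus comes from the separator bound, or, if the neighborhoods cover
        \<open>V\<close>, from \<open>X\<close>, which is disjoint from \<open>W\<close>.\<close>
      have "k \<le> card (?N - W)"
      proof (cases "?N = V")
        case True
        then show ?thesis using W assms(2,3,4) card_mono[of "V - W" X] by auto
      next
        case False
        then show ?thesis using separator_card[OF assms(1,2) _ \<open>W \<noteq> {}\<close>] W by blast
      qed
      then have "card W + k \<le> card ?N"
        using card_Diff_subset[OF finW N(2)] card_mono[OF finN N(2)] by linarith
      also have "card ?N \<le> card ((?N - U) \<union> U)"
        by (rule card_mono) (use finN fin in auto)
      also have "\<dots> \<le> card (?N - U) + card U" by (rule card_Un_le)
      also have "?N - U = (\<Union>w\<in>W. closed_nbhd V E w - U)" by blast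
      finally show ?thesis using assms(6) by simp
    qed simp
  qed
  then obtain f where f: "inj_on f (V - X)" "\<forall>v\<in>V - X. f v \<in> closed_nbhd V E v - U" by blast
  have "f ` (V - X) = V - U"
  proof (rule card_subset_eq)
    show "f ` (V - X) \<subseteq> V - U" using f(2) closed_nbhd_subset[of _ V E] by blast
    show "card (f ` (V - X)) = card (V - U)"
      using f(1) assms fin by (simp add: card_image card_Diff_subset)
  qed (use assms(2) in simp)
  with f show ?thesis by (intro that[of f]) (auto simp: bij_betw_def)
qed

section \<open>Rubber band placements and trivial lifts\<close>

text \<open>Nonsingularity for a fixed \<open>U\<close> is guaranteed by a nonzero polynomial in the
  weights, and there are finitely many \<open>U\<close>, so one choice of weights serves all of
  them.\<close>

lemma generic_weights:
  assumes "vertex_connected V E k" "finite V" "X \<subseteq> V" "card X = k"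
  obtains \<Omega> :: "'a \<Rightarrow> 'a \<Rightarrow> real" where
    "\<And>v w. w \<notin> closed_nbhd V E v \<Longrightarrow> \<Omega> v w = 0"
    "\<And>U. U \<subseteq> V \<Longrightarrow> card U = k \<Longrightarrow> trivial_kernel (V - X) (V - U) \<Omega>"
proof -
  define \<U> where "\<U> = {U. U \<subseteq> V \<and> card U = k}"
  have "finite \<U>" using assms(2) by (simp add: \<U>_def)
  define A :: "'a \<Rightarrow> 'a \<Rightarrow> ('a \<times> 'a \<Rightarrow> real) \<Rightarrow> real"
    where "A v w x = (if w \<in> closed_nbhd V E v then x (v, w) else 0)" for v w x
  have A: "rat_polyfun UNIV (A v w)" for v w
    using rat_polyfun.var[of "(v, w)" UNIV] rat_polyfun_0 by (cases "w \<in> closed_nbhd V E v") (simp_all add: A_def[abs_def])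
  have "\<exists>F. rat_polyfun UNIV F \<and> (\<exists>x. F x \<noteq> 0)
      \<and> (\<forall>x. F x \<noteq> 0 \<longrightarrow> trivial_kernel (V - X) (V - U) (\<lambda>v w. A v w x))" if U: "U \<in> \<U>" for U
  proof -
    obtain f where f: "bij_betw f (V - X) (V - U)"
      "\<And>v. v \<in> V - X \<Longrightarrow> f v \<in> closed_nbhd V E v"
      using vertex_connected_matching[OF assms, of U] U unfolding \<U>_def by blast
    \<comment> \<open>Weight 1 on the matching edges and 0 elsewhere turns the submatrix into a
      permutation matrix.\<close>
    define x where "x = (\<lambda>(v, w). if w = f v then 1 else (0::real))"
    have "trivial_kernel (V - X) (V - U) (\<lambda>v w. A v w x)"
      unfolding trivial_kernel_def
    proof (intro allI impI ballI)
      fix z w assume z: "\<forall>v\<in>V - X. (\<Sum>w\<in>V - U. A v w x * z w) = 0" and w: "w \<in> V - U"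
      have "w \<in> f ` (V - X)" using w bij_betw_imp_surj_on[OF f(1)] by simp
      then obtain v where v: "v \<in> V - X" "f v = w" by blast
      have "0 = (\<Sum>w'\<in>V - U. A v w' x * z w')" using z v by simp
      also have "\<dots> = (\<Sum>w'\<in>V - U. if w' = w then z w' else 0)"
        by (rule sum.cong) (use f(2)[OF v(1)] v(2) in \<open>auto simp: A_def x_def\<close>)
      also have "\<dots> = z w" using assms(2) w by simp
      finally show "z w = 0" by simp
    qed
    from rat_polyfun_trivial_kernel[where A = A, OF finite_Diff[OF assms(2)] A this] show ?thesis
      by blast
  qed
  then obtain F where F: "\<And>U. U \<in> \<U> \<Longrightarrow> rat_polyfun UNIV (F U)" "\<And>U. U \<in> \<U> \<Longrightarrow> \<exists>x. F U x \<noteq> 0"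
    "\<And>U x. U \<in> \<U> \<Longrightarrow> F U x \<noteq> 0 \<Longrightarrow> trivial_kernel (V - X) (V - U) (\<lambda>v w. A v w x)"
    by metis
  obtain x where "\<forall>U\<in>\<U>. F U x \<noteq> 0"
    using rat_polyfun_common_nonzero[where F = F, OF \<open>finite \<U>\<close> F(1,2)] by blast
  then show ?thesis
    using F(3) by (intro that[of "\<lambda>v w. A v w x"]) (auto simp: A_def \<U>_def)
qed

text \<open>Homogeneous coordinates \<open>P v\<close>: a lift assigns heights \<open>q\<close> to the vertices so that the heights
  over each \<open>N u\<close> lie on a common hyperplane \<open>a u\<close>.\<close>
definition only_trivial_lift ::
  "'a set \<Rightarrow> 'a set \<Rightarrow> ('a \<Rightarrow> 'a set) \<Rightarrow> ('a \<Rightarrow> 'i::finite \<Rightarrow> real) \<Rightarrow> bool" where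
  "only_trivial_lift V X N P \<longleftrightarrow> (\<forall>q a.
     (\<forall>x\<in>X. q x = 0) \<and> (\<forall>u\<in>V - X. \<forall>v\<in>N u. q v = (\<Sum>i\<in>UNIV. a u i * P v i))
     \<longrightarrow> (\<forall>v\<in>V. q v = 0) \<and> (\<forall>u\<in>V - X. \<forall>i. a u i = 0))"

text \<open>Projective invariance: rescaling the vector of a vertex is absorbed by rescaling its
  height, with the hyperplanes \<open>a u\<close> unchanged.\<close>

lemma only_trivial_lift_scale:
  assumes "only_trivial_lift V X N P" "\<And>u. u \<in> V - X \<Longrightarrow> N u \<subseteq> V" "\<And>v. v \<in> V \<Longrightarrow> c v \<noteq> 0"
  shows "only_trivial_lift V X N (\<lambda>v i. P v i / c v)"
  unfolding only_trivial_lift_def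
proof (intro allI impI)
  fix q a
  assume h: "(\<forall>x\<in>X. q x = 0) \<and> (\<forall>u\<in>V - X. \<forall>v\<in>N u. q v = (\<Sum>i\<in>UNIV. a u i * (P v i / c v)))"
  have "c v * q v = (\<Sum>i\<in>UNIV. a u i * P v i)" if "u \<in> V - X" "v \<in> N u" for u v
  proof -
    have "c v \<noteq> 0" using assms(2,3) that by blast
    then show ?thesis using h that by (simp add: sum_distrib_left)
  qed
  then have "(\<forall>v\<in>V. c v * q v = 0) \<and> (\<forall>u\<in>V - X. \<forall>i. a u i = 0)"
    using assms(1)[unfolded only_trivial_lift_def, THEN spec[of _ "\<lambda>v. c v * q v"], THEN spec[of _ a]] h
    by simp
  then show "(\<forall>v\<in>V. q v = 0) \<and> (\<forall>u\<in>V - X. \<forall>i. a u i = 0)" using assms(3) by simp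
qed

lemma rat_polyfun_only_trivial_lift:
  fixes Q :: "'a \<Rightarrow> 'i::finite \<Rightarrow> ('k \<Rightarrow> real) \<Rightarrow> real"
  assumes "finite V" "X \<subseteq> V" "\<And>u. u \<in> V - X \<Longrightarrow> N u \<subseteq> V"
    and "\<And>v i. v \<in> V \<Longrightarrow> rat_polyfun K (Q v i)"
    and "only_trivial_lift V X N (\<lambda>v i. Q v i x0)"
  shows "\<exists>F. rat_polyfun K F \<and> F x0 \<noteq> 0
    \<and> (\<forall>x. F x \<noteq> 0 \<longrightarrow> only_trivial_lift V X N (\<lambda>v i. Q v i x))"
proof -
  let ?I = "Sigma (V - X) N"
  \<comment> \<open>Unknowns are the heights outside \<open>X\<close> (\<open>Inl\<close>) and the
    hyperplane coefficients (\<open>Inr\<close>), with one equation per incidence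
    \<open>(u, v)\<close>. Heights on \<open>X\<close> are already replaced by 0, which is why
    \<open>row\<close> has a zero default.\<close>
  let ?J = "(V - X) <+> ((V - X) \<times> (UNIV :: 'i set))"
  define A :: "'a \<times> 'a \<Rightarrow> 'a + 'a \<times> 'i \<Rightarrow> ('k \<Rightarrow> real) \<Rightarrow> real"
    where "A = (\<lambda>(u, v) j x. case j of Inl w \<Rightarrow> if w = v then 1 else 0
      | Inr (u', i) \<Rightarrow> if u' = u then - Q v i x else 0)"
  have fin: "finite (V - X)" using assms(1) by simp
  then have finJ: "finite ?J" by simp
  have row: "(\<Sum>j\<in>?J. A (u, v) j x * z j)
      = (if v \<in> V - X then z (Inl v) else 0) - (\<Sum>i\<in>UNIV. z (Inr (u, i)) * Q v i x)"
    if "u \<in> V - X" for u v x z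
  proof -
    have "(\<Sum>w\<in>V - X. A (u, v) (Inl w) x * z (Inl w)) = (\<Sum>w\<in>V - X. if w = v then z (Inl w) else 0)"
      by (rule sum.cong) (auto simp: A_def)
    moreover have "(\<Sum>j\<in>(V - X) \<times> UNIV. A (u, v) (Inr j) x * z (Inr j))
        = (\<Sum>u'\<in>V - X. \<Sum>i\<in>UNIV. A (u, v) (Inr (u', i)) x * z (Inr (u', i)))"
      by (simp add: sum.cartesian_product)
    moreover have "\<dots> = (\<Sum>u'\<in>V - X. if u' = u then - (\<Sum>i\<in>UNIV. z (Inr (u, i)) * Q v i x) else 0)"
      by (rule sum.cong) (auto simp: A_def mult.commute simp flip: sum_negf)
    ultimately show ?thesis
      using fin that by (simp add: sum.Plus)
  qed
  have iff: "only_trivial_lift V X N (\<lambda>v i. Q v i x) \<longleftrightarrow> trivial_kernel ?I ?J (\<lambda>i j. A i j x)" for x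
  proof
    assume L: "only_trivial_lift V X N (\<lambda>v i. Q v i x)"
    show "trivial_kernel ?I ?J (\<lambda>i j. A i j x)"
      unfolding trivial_kernel_def
    proof (intro allI impI)
      fix z assume z: "\<forall>i\<in>?I. (\<Sum>j\<in>?J. A i j x * z j) = 0"
      let ?q = "\<lambda>v. if v \<in> V - X then z (Inl v) else 0"
      have "?q v = (\<Sum>i\<in>UNIV. z (Inr (u, i)) * Q v i x)" if "u \<in> V - X" "v \<in> N u" for u v
        using z[rule_format, of "(u, v)"] row[OF that(1), of v x z] that by simp
      then have "(\<forall>v\<in>V. ?q v = 0) \<and> (\<forall>u\<in>V - X. \<forall>i. z (Inr (u, i)) = 0)"
        using L[unfolded only_trivial_lift_def, THEN spec[of _ ?q], THEN spec[of _ "\<lambda>u i. z (Inr (u, i))"]]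
        by simp
      then show "\<forall>j\<in>?J. z j = 0" by auto
    qed
  next
    assume R: "trivial_kernel ?I ?J (\<lambda>i j. A i j x)"
    show "only_trivial_lift V X N (\<lambda>v i. Q v i x)"
      unfolding only_trivial_lift_def
    proof (intro allI impI)
      fix q a
      assume h: "(\<forall>x\<in>X. q x = 0) \<and> (\<forall>u\<in>V - X. \<forall>v\<in>N u. q v = (\<Sum>i\<in>UNIV. a u i * Q v i x))"
      let ?z = "\<lambda>j. case j of Inl v \<Rightarrow> q v | Inr (u, i) \<Rightarrow> a u i"
      have "(\<Sum>j\<in>?J. A i j x * ?z j) = 0" if ij: "i \<in> ?I" for i
      proof -
        obtain u v where i: "i = (u, v)" "u \<in> V - X" "v \<in> N u" using ij by blast
        have "v \<in> V" using assms(3) i by blast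
        have "q v = (\<Sum>i\<in>UNIV. a u i * Q v i x)" using h i by blast
        moreover have "v \<notin> V - X \<Longrightarrow> q v = 0" using h \<open>v \<in> V\<close> by blast
        ultimately show ?thesis using row[OF i(2), of v x ?z] i(1) by auto
      qed
      then have "\<forall>j\<in>?J. ?z j = 0" using R unfolding trivial_kernel_def by blast
      then have "?z (Inl v) = 0" "?z (Inr (v, i)) = 0" if "v \<in> V - X" for v i
        using that by blast+
      then show "(\<forall>v\<in>V. q v = 0) \<and> (\<forall>u\<in>V - X. \<forall>i. a u i = 0)"
        using h by auto
    qed
  qed
  have poly: "rat_polyfun K (A i j)" if ij: "i \<in> ?I" "j \<in> ?J" for i j
  proof -
    obtain u v where i: "i = (u, v)" "u \<in> V - X" "v \<in> N u" using ij(1) by blast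
    then have v: "v \<in> V" using assms(3) by blast
    show ?thesis
    proof (cases j)
      case (Inl w)
      then show ?thesis
        using rat_polyfun_0[of K] rat_polyfun_1[of K] i by (cases "w = v") (simp_all add: A_def)
    next
      case (Inr j')
      obtain u' l where "j' = (u', l)" by fastforce
      then show ?thesis
        using Inr rat_polyfun_0[of K] rat_polyfun_minus[OF assms(4)[OF v, of l]] i
        by (cases "u' = u") (simp_all add: A_def)
    qed
  qed
  show ?thesis
    using rat_polyfun_trivial_kernel[where A = A, OF finJ poly assms(5)[unfolded iff]]
    unfolding iff .
qed

lemma exists_only_trivial_lift:
  assumes "vertex_connected V E k" "finite V" "X \<subseteq> V" "card X = k" "k \<le> card V"
    and "k = CARD('i)"
  shows "\<exists>P :: 'a \<Rightarrow> 'i::finite \<Rightarrow> real. only_trivial_lift V X (closed_nbhd V E) P"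
proof -
  obtain \<Omega> :: "'a \<Rightarrow> 'a \<Rightarrow> real" where \<Omega>: "\<And>v w. w \<notin> closed_nbhd V E v \<Longrightarrow> \<Omega> v w = 0"
    "\<And>U. U \<subseteq> V \<Longrightarrow> card U = k \<Longrightarrow> trivial_kernel (V - X) (V - U) \<Omega>"
    using generic_weights[OF assms(1-4)] by blast
  have finX: "finite X" using finite_subset[OF assms(3,2)] .
  obtain \<beta> where \<beta>: "bij_betw \<beta> X (UNIV :: 'i set)"
    using finite_same_card_bij[OF finX finite] assms(4,6) by metis
  define \<delta> where "\<delta> x i = (if \<beta> x = i then 1 else (0::real))" for x i
  have "\<exists>z. \<forall>v\<in>V - X. (\<Sum>w\<in>V - X. \<Omega> v w * z w) = - (\<Sum>x\<in>X. \<Omega> v x * \<delta> x i)" for i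
    by (rule square_trivial_kernel_solvable[OF _ _ refl \<Omega>(2)[OF assms(3,4)]])
      (use assms(2) in simp_all)
  then obtain z where z: "\<And>i v. v \<in> V - X \<Longrightarrow>
      (\<Sum>w\<in>V - X. \<Omega> v w * z i w) = - (\<Sum>x\<in>X. \<Omega> v x * \<delta> x i)"
    by metis
  define P where "P v i = (if v \<in> X then \<delta> v i else z i v)" for v i
  have equilibrium: "(\<Sum>w\<in>V. \<Omega> v w * P w i) = 0" if "v \<in> V - X" for v i
  proof -
    have "(\<Sum>w\<in>V. \<Omega> v w * P w i) = (\<Sum>w\<in>V - X. \<Omega> v w * P w i) + (\<Sum>w\<in>X. \<Omega> v w * P w i)"
      using assms(2,3) by (simp add: sum.subset_diff)
    also have "\<dots> = (\<Sum>w\<in>V - X. \<Omega> v w * z i w) + (\<Sum>x\<in>X. \<Omega> v x * \<delta> x i)"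
      by (simp add: P_def)
    finally show ?thesis using z[OF that] by simp
  qed
  \<comment> \<open>A function in equilibrium at all vertices outside \<open>X\<close> is determined
    by its values on any \<open>k\<close> vertices. This is used twice: for the heights, zero on
    \<open>X\<close>, and for the linear forms \<open>a u\<close>.\<close>
  have kernel: "q w = 0"
    if q: "\<And>v. v \<in> V - X \<Longrightarrow> (\<Sum>w\<in>V. \<Omega> v w * q w) = 0"
      and U: "U \<subseteq> V" "card U = k" "\<And>w. w \<in> U \<Longrightarrow> q w = 0" and w: "w \<in> V" for q U w
  proof (cases "w \<in> U")
    case False
    have "(\<Sum>w\<in>V - U. \<Omega> v w * q w) = 0" if "v \<in> V - X" for v
    proof -
      have "(\<Sum>w\<in>V - U. \<Omega> v w * q w) = (\<Sum>w\<in>V. \<Omega> v w * q w)"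
        using U assms(2) by (intro sum.mono_neutral_left) auto
      with q[OF that] show ?thesis by simp
    qed
    then show ?thesis
      using trivial_kernelD[OF \<Omega>(2)[OF U(1,2)], of q w] w False by simp
  qed (use U in simp)
  have "only_trivial_lift V X (closed_nbhd V E) P"
    unfolding only_trivial_lift_def
  proof (intro allI impI)
    fix q a
    assume h: "(\<forall>x\<in>X. q x = 0)
      \<and> (\<forall>u\<in>V - X. \<forall>v\<in>closed_nbhd V E u. q v = (\<Sum>i\<in>UNIV. a u i * P v i))"
    have comb: "(\<Sum>w\<in>V. \<Omega> v w * (\<Sum>i\<in>UNIV. c i * P w i)) = 0" if "v \<in> V - X" for v c
    proof -
      have "(\<Sum>w\<in>V. \<Omega> v w * (\<Sum>i\<in>UNIV. c i * P w i)) = (\<Sum>i\<in>UNIV. c i * (\<Sum>w\<in>V. \<Omega> v w * P w i))"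
        by (simp add: sum_distrib_left mult.left_commute sum.swap[of _ UNIV V])
      then show ?thesis using equilibrium[OF that] by simp
    qed
    \<comment> \<open>The weights at \<open>v\<close> only see its closed neighborhood, where
      \<open>q\<close> agrees with the linear form \<open>a v\<close>; that form inherits
      equilibrium from the coordinates of \<open>P\<close>.\<close>
    have harmonic: "(\<Sum>w\<in>V. \<Omega> v w * q w) = 0" if v: "v \<in> V - X" for v
    proof -
      have "(\<Sum>w\<in>V. \<Omega> v w * q w) = (\<Sum>w\<in>V. \<Omega> v w * (\<Sum>i\<in>UNIV. a v i * P w i))"
      proof (rule sum.cong)
        fix w assume "w \<in> V"
        show "\<Omega> v w * q w = \<Omega> v w * (\<Sum>i\<in>UNIV. a v i * P w i)"
          using conjunct2[OF h, rule_format, OF v] \<Omega>(1)[of w v]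
          by (cases "w \<in> closed_nbhd V E v") auto
      qed simp
      with comb[OF v] show ?thesis by simp
    qed
    have q0: "q v = 0" if "v \<in> V" for v
      by (rule kernel[OF harmonic assms(3,4) bspec[OF conjunct1[OF h]] that])
    moreover have "a u i = 0" if u: "u \<in> V - X" for u i
    proof -
      have sub: "closed_nbhd V E u \<subseteq> V" using closed_nbhd_subset[of u V E] u by blast
      \<comment> \<open>The form \<open>a u\<close> vanishes on these \<open>k\<close> vertices
        because \<open>q\<close> does, hence at every vertex. Evaluating it at the vertex of
        \<open>X\<close> pinned to the basis vector \<open>i\<close> isolates
        \<open>a u i\<close>.\<close>
      obtain U where U: "U \<subseteq> closed_nbhd V E u" "card U = k"
        by (rule obtain_subset_with_card_n[OF closed_nbhd_card[OF assms(1,2,5), of u]]) (use u in auto)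
      have "(\<Sum>i\<in>UNIV. a u i * P w i) = 0" if "w \<in> V" for w
      proof (rule kernel[OF comb])
        show "U \<subseteq> V" using U sub by blast
        show "(\<Sum>i\<in>UNIV. a u i * P w i) = 0" if "w \<in> U" for w
        proof -
          have "w \<in> closed_nbhd V E u" using U that by blast
          then show ?thesis using conjunct2[OF h, rule_format, OF u] q0[of w] sub by auto
        qed
      qed (use U that in auto)
      moreover obtain x where x: "x \<in> X" "\<beta> x = i" using \<beta> by (metis UNIV_I bij_betw_def imageE)
      ultimately have "(\<Sum>i\<in>UNIV. a u i * P x i) = 0" using assms(3) by blast
      moreover have "(\<Sum>j\<in>UNIV. a u j * P x j) = (\<Sum>j\<in>UNIV. if i = j then a u j else 0)"
        by (rule sum.cong) (use x in \<open>auto simp: P_def \<delta>_def\<close>)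
      ultimately show ?thesis by simp
    qed
    ultimately show "(\<forall>v\<in>V. q v = 0) \<and> (\<forall>u\<in>V - X. \<forall>i. a u i = 0)" by blast
  qed
  then show ?thesis by blast
qed

section \<open>From homogeneous to affine coordinates\<close>

definition homogenize :: "('a \<times> 'd \<Rightarrow> real) \<Rightarrow> 'a \<Rightarrow> 'd option \<Rightarrow> real" where
  "homogenize x v i = (case i of None \<Rightarrow> 1 | Some j \<Rightarrow> x (v, j))"

lemma rat_polyfun_homogenize:
  "v \<in> V \<Longrightarrow> rat_polyfun (V \<times> UNIV) (\<lambda>x. homogenize x v i)"
  by (cases i) (simp_all add: homogenize_def rat_polyfun_1 rat_polyfun.var)

lemma sum_homogenize:
  fixes x :: "'a \<times> 'd::finite \<Rightarrow> real"
  shows "(\<Sum>i\<in>UNIV. homogenize x v i * a i) = a None + (\<Sum>j\<in>UNIV. x (v, j) * a (Some j))"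
  by (simp add: UNIV_option_conv sum.reindex homogenize_def)

text \<open>A homogeneous placement may put vertices at infinity, as basis vectors with
  \<open>None\<close> entry 0 do. Some placement makes both \<open>F\<close> and all
  \<open>None\<close> entries nonzero; dividing by the latter gives an affine one.\<close>

lemma exists_affine_only_trivial_lift:
  assumes "vertex_connected V E (CARD('d) + 1)" "finite V" "X \<subseteq> V" "card X = CARD('d) + 1"
    and "CARD('d) + 1 \<le> card V"
  obtains x :: "'a \<times> 'd::finite \<Rightarrow> real"
  where "only_trivial_lift V X (closed_nbhd V E) (homogenize x)"
proof -
  let ?N = "closed_nbhd V E"
  have sub: "\<And>u. u \<in> V - X \<Longrightarrow> ?N u \<subseteq> V" using closed_nbhd_subset[of _ V E] by simp
  obtain P0 :: "'a \<Rightarrow> 'd option \<Rightarrow> real" where P0: "only_trivial_lift V X ?N P0"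
    using exists_only_trivial_lift[OF assms, where 'i = "'d option"] by auto
  let ?K = "UNIV :: ('a \<times> 'd option) set"
  have var: "rat_polyfun ?K (\<lambda>x. x (v, i))" for v i by (rule rat_polyfun.var) simp
  obtain F where F: "rat_polyfun ?K F" "F (\<lambda>(v, i). P0 v i) \<noteq> 0"
    "\<And>x. F x \<noteq> 0 \<Longrightarrow> only_trivial_lift V X ?N (\<lambda>v i. x (v, i))"
    using rat_polyfun_only_trivial_lift[where N = ?N and Q = "\<lambda>v i x. x (v, i)" and
        ?x0.0 = "\<lambda>(v, i). P0 v i", OF assms(2,3) sub var] P0 by auto
  let ?L = "\<lambda>x :: 'a \<times> 'd option \<Rightarrow> real. \<Prod>v\<in>V. x (v, None)"
  have L: "rat_polyfun ?K ?L" by (intro rat_polyfun_prod var)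
  obtain x where x: "F x \<noteq> 0" "?L x \<noteq> 0"
    using rat_polyfun_common_nonzero2[where f = F and g = ?L and b = "\<lambda>_. 1", OF F(1) L F(2)]
    by auto
  then have nz: "\<And>v. v \<in> V \<Longrightarrow> x (v, None) \<noteq> 0" using assms(2) by auto
  let ?y = "\<lambda>(v, j). x (v, Some j) / x (v, None)"
  have scaled: "only_trivial_lift V X ?N (\<lambda>v i. x (v, i) / x (v, None))"
    using only_trivial_lift_scale[OF F(3)[OF x(1)] sub, of "\<lambda>v. x (v, None)"] nz by blast
  have y: "x (v, i) / x (v, None) = homogenize ?y v i" if "v \<in> V" for v i
    using nz[OF that] by (cases i) (simp_all add: homogenize_def)
  have "(\<Sum>i\<in>UNIV. a u i * (x (v, i) / x (v, None))) = (\<Sum>i\<in>UNIV. a u i * homogenize ?y v i)"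
    if "u \<in> V - X" "v \<in> ?N u" for a :: "'a \<Rightarrow> 'd option \<Rightarrow> real" and u v
    using subsetD[OF sub[OF that(1)] that(2)] by (simp only: y)
  then have "only_trivial_lift V X ?N (homogenize ?y)"
    using scaled unfolding only_trivial_lift_def by simp blast
  then show ?thesis by (rule that)
qed

lemma generic_only_trivial_lift:
  fixes p :: "'a \<Rightarrow> real^'d"
  assumes "vertex_connected V E (CARD('d) + 1)" "finite V" "X \<subseteq> V" "card X = CARD('d) + 1"
    and "CARD('d) + 1 \<le> card V" "generic V p"
  shows "only_trivial_lift V X (closed_nbhd V E) (homogenize (\<lambda>(v, j). p v $ j))"
proof -
  obtain x0 :: "'a \<times> 'd \<Rightarrow> real" where x0: "only_trivial_lift V X (closed_nbhd V E) (homogenize x0)"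
    using exists_affine_only_trivial_lift[OF assms(1-5)] by blast
  have sub: "\<And>u. u \<in> V - X \<Longrightarrow> closed_nbhd V E u \<subseteq> V" using closed_nbhd_subset[of _ V E] by simp
  obtain F where F: "rat_polyfun (V \<times> UNIV) F" "F x0 \<noteq> 0"
    "\<And>x. F x \<noteq> 0 \<Longrightarrow> only_trivial_lift V X (closed_nbhd V E) (homogenize x)"
    using rat_polyfun_only_trivial_lift[where Q = "\<lambda>v i x. homogenize x v i",
        OF assms(2,3) sub rat_polyfun_homogenize x0] by blast
  show ?thesis
    by (rule F(3), rule generic_rat_polyfun_nonzero[OF assms(6,2) F(1,2)])
qed

lemma generic_affinely_independent:
  fixes p :: "'a \<Rightarrow> real^'d"
  assumes "finite V" "generic V p" "U \<subseteq> V" "card U = CARD('d) + 1"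
  shows "trivial_kernel U UNIV (homogenize (\<lambda>(v, j). p v $ j))"
proof -
  have "finite U" using finite_subset[OF assms(3,1)] .
  then obtain \<beta> where \<beta>: "bij_betw \<beta> U (UNIV :: 'd option set)"
    using finite_same_card_bij[OF _ finite, of U "UNIV :: 'd option set"] assms(4) by auto
  \<comment> \<open>The origin and the standard unit vectors, the vertices of a nondegenerate
    simplex.\<close>
  define x0 where "x0 = (\<lambda>(v, j). if \<beta> v = Some j then 1 else (0::real))"
  have base: "trivial_kernel U UNIV (homogenize x0)"
    unfolding trivial_kernel_def
  proof (intro allI impI ballI)
    fix a i assume a: "\<forall>v\<in>U. (\<Sum>i\<in>UNIV. homogenize x0 v i * a i) = 0"
    have eq: "a None + (case \<beta> v of None \<Rightarrow> 0 | Some j \<Rightarrow> a (Some j)) = 0" if "v \<in> U" for v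
    proof -
      have "(\<Sum>j\<in>UNIV. x0 (v, j) * a (Some j)) = (\<Sum>j\<in>UNIV. if \<beta> v = Some j then a (Some j) else 0)"
        by (rule sum.cong) (auto simp: x0_def)
      also have "\<dots> = (case \<beta> v of None \<Rightarrow> 0 | Some j \<Rightarrow> a (Some j))"
        by (cases "\<beta> v") simp_all
      finally show ?thesis using a[rule_format, OF that] by (simp only: sum_homogenize)
    qed
    have "\<exists>v\<in>U. \<beta> v = i" for i using \<beta> by (metis UNIV_I bij_betw_def imageE)
    then obtain v w where v: "v \<in> U" "\<beta> v = None" and w: "w \<in> U" "\<beta> w = i" by metis
    show "a i = 0" using eq[OF v(1)] eq[OF w(1)] v(2) w(2) by (cases i) simp_all
  qed
  obtain F where F: "rat_polyfun (V \<times> UNIV) F" "F x0 \<noteq> 0"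
    "\<And>x. F x \<noteq> 0 \<Longrightarrow> trivial_kernel U UNIV (homogenize x)"
    using rat_polyfun_trivial_kernel[where A = "\<lambda>v i x. homogenize x v i", OF finite
        rat_polyfun_homogenize[OF subsetD[OF assms(3)]] base] by blast
  show ?thesis
    by (rule F(3), rule generic_rat_polyfun_nonzero[OF assms(2,1) F(1,2)])
qed

section \<open>Affine rigidity\<close>

theorem theorem5p1:
  fixes V :: "'a set" and E :: "'a \<Rightarrow> 'a \<Rightarrow> bool" and p :: "'a \<Rightarrow> real^'d"
  assumes "simple_graph V E"
    and "card V \<ge> CARD('d) + 1"
    and "vertex_connected V E (CARD('d) + 1)"
    and "generic V p"
  shows "affinely_rigid V (nbhd_hypergraph V E) p"
  unfolding affinely_rigid_def
proof (intro allI impI)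
  fix q :: "'a \<Rightarrow> real^'d"
  assume q: "affinely_equivalent (nbhd_hypergraph V E) p q"
  have finV: "finite V" using assms(1) by (simp add: simple_graph_def)
  let ?N = "closed_nbhd V E"
  let ?h = "homogenize (\<lambda>(v, j). p v $ j)"
  have affine: "(A *v p v + b) $ k = (\<Sum>i\<in>UNIV. ?h v i * (case i of None \<Rightarrow> b $ k | Some j \<Rightarrow> A $ k $ j))"
    for A :: "real^'d^'d" and b v k
    by (simp add: sum_homogenize matrix_vector_mult_def mult.commute)
  obtain X where X: "X \<subseteq> V" "card X = CARD('d) + 1"
    by (rule obtain_subset_with_card_n[OF assms(2)])
  have finX: "finite X" using finite_subset[OF X(1) finV] .
  have "?N u \<in> nbhd_hypergraph V E" if "u \<in> V" for u
    using that by (auto simp: nbhd_hypergraph_def closed_nbhd_def)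
  then have "\<forall>u\<in>V. \<exists>(B::real^'d^'d) c. invertible B \<and> (\<forall>v\<in>?N u. q v = B *v p v + c)"
    using q unfolding affinely_equivalent_def by blast
  then obtain B :: "'a \<Rightarrow> real^'d^'d" and c where
    B: "\<And>u. u \<in> V \<Longrightarrow> invertible (B u)" "\<And>u v. u \<in> V \<Longrightarrow> v \<in> ?N u \<Longrightarrow> q v = B u *v p v + c u"
    by metis
  have indep: "trivial_kernel U UNIV ?h" if "U \<subseteq> V" "card U = CARD('d) + 1" for U
    using generic_affinely_independent[OF finV assms(4) that] .
  \<comment> \<open>For each coordinate \<open>k\<close>, \<open>z k\<close> holds the coefficients
    of the affine function interpolating \<open>q\<close> on the simplex \<open>X\<close>.\<close>
  have "\<exists>z. \<forall>v\<in>X. (\<Sum>i\<in>UNIV. ?h v i * z i) = q v $ k" for k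
    by (rule square_trivial_kernel_solvable[OF finX finite _ indep[OF X]]) (use X(2) in simp)
  then obtain z where z: "\<And>k v. v \<in> X \<Longrightarrow> (\<Sum>i\<in>UNIV. ?h v i * z k i) = q v $ k" by metis
  define A :: "real^'d^'d" where "A = (\<chi> k j. z k (Some j))"
  define b :: "real^'d" where "b = (\<chi> k. z k None)"
  have Az: "(A *v p v + b) $ k = (\<Sum>i\<in>UNIV. ?h v i * z k i)" for v k
    unfolding affine by (rule sum.cong) (auto simp: A_def b_def split: option.split)
  have eq: "q v = A *v p v + b" if "v \<in> V" for v
  proof (rule vec_eq_iff[THEN iffD2], rule allI)
    fix k
    \<comment> \<open>The interpolation error is a lift: it is zero on \<open>X\<close>, and on each
      closed neighborhood it is the difference of two affine functions, with coefficients
      \<open>?a\<close>.\<close>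
    let ?r = "\<lambda>v. (q v - (A *v p v + b)) $ k"
    let ?a = "\<lambda>u i. (case i of None \<Rightarrow> c u $ k | Some j \<Rightarrow> B u $ k $ j) - z k i"
    have "?r x = 0" if "x \<in> X" for x
      using z[OF that, of k] Az[of x k] by simp
    moreover have "?r v = (\<Sum>i\<in>UNIV. ?a u i * ?h v i)" if "u \<in> V - X" "v \<in> ?N u" for u v
    proof -
      have "?r v = (B u *v p v + c u) $ k - (A *v p v + b) $ k"
        using B(2)[of u v] that by simp
      also have "\<dots> = (\<Sum>i\<in>UNIV. ?a u i * ?h v i)"
        unfolding Az unfolding affine by (simp add: sum_subtractf algebra_simps)
      finally show ?thesis .
    qed
    ultimately have "?r v = 0"
      using generic_only_trivial_lift[OF assms(3) finV X assms(2,4), unfolded only_trivial_lift_def,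
          THEN spec[of _ ?r], THEN spec[of _ ?a]] \<open>v \<in> V\<close> by blast
    then show "q v $ k = (A *v p v + b) $ k" by simp
  qed
  \<comment> \<open>It remains to see that \<open>A\<close> is invertible. The interpolating map
    agrees with an invertible local map on \<open>d + 1\<close> affinely independent points of one
    closed neighborhood, so the linear parts coincide.\<close>
  obtain u where u: "u \<in> V" using assms(2) by fastforce
  obtain U where U: "U \<subseteq> ?N u" "card U = CARD('d) + 1"
    by (rule obtain_subset_with_card_n[OF closed_nbhd_card[OF assms(3) finV assms(2) u]])
  have UV: "U \<subseteq> V" using U closed_nbhd_subset[OF u, of E] by blast
  have "A $ k $ j = B u $ k $ j" for k j
  proof -
    let ?a = "\<lambda>i. (case i of None \<Rightarrow> c u $ k | Some j \<Rightarrow> B u $ k $ j) - z k i"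
    have "(\<Sum>i\<in>UNIV. ?h v i * ?a i) = 0" if "v \<in> U" for v
    proof -
      have "(B u *v p v + c u) $ k = (A *v p v + b) $ k"
        using eq[of v] B(2)[OF u, of v] U UV that by (metis subsetD)
      then show ?thesis
        unfolding Az unfolding affine by (simp add: sum_subtractf right_diff_distrib)
    qed
    from trivial_kernelD[OF indep[OF UV U(2)] this, of "Some j"] show ?thesis
      by (simp add: A_def)
  qed
  then have "A = B u" by (simp add: vec_eq_iff)
  then have "invertible A" using B(1)[OF u] by simp
  with eq show "affinely_congruent V p q" unfolding affinely_congruent_def by blast
qed

end
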